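(* Let $X \in \mathbb{R}^{N\times D}$ and $W_h^Q, W_h^K, W_h^V\in\mathbb{R}^{D\times d}$, let $P^h = \mathrm{sm}\big(\tfrac{1}{\sqrt d}XW_h^Q(W_h^K)^\top X^\top\big)\in\mathbb{R}^{N\times N}$, and let $\mathrm{Attn}_h(X) = P^h X W_h^V\in\mathbb{R}^{N\times d}$ be the dot-product self-attention. Then $$\left\|\frac{\partial\,\mathrm{Attn}_h(X)}{\partial W_h^Q}\right\|_2 \leqslant \frac{1}{\sqrt d}\,\|W_h^V\|_2\,\|W_h^K\|_2\,\|X\|_2^3\,\max_{i=1,\dots,N}\|\mathcal{M}(P^h_{i,:})\|_2,$$ $$\left\|\frac{\partial\,\mathrm{Attn}_h(X)}{\partial W_h^K}\right\|_2 \leqslant \frac{1}{\sqrt d}\,\|W_h^V\|_2\,\|W_h^Q\|_2\,\|X\|_2^3\,\max_{i=1,\dots,N}\|\mathcal{M}(P^h_{i,:})\|_2,$$ and $$\left\|\frac{\partial\,\mathrm{Attn}_h(X)}{\partial W_h^V}\right\|_2 \leqslant \|P^h\|_2\,\|X\|_2 \leqslant \sqrt{\max_{j}\sum_{i=1}^N P^h_{ij}}\;\|X\|_2.$$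
   Context: $\mathrm{sm}$ denotes the row-wise softmax: for a vector $z\in\mathbb{R}^N$, $\mathrm{sm}(z)_i = e^{z_i}/\sum_{j=1}^N e^{z_j}$, and for a matrix it is applied to each row separately. $P^h_{i,:}$ denotes the $i$-th row of $P^h$. For a vector $x\in\mathbb{R}^N$ (regarded as a column vector), $\mathcal{M}(x) = \mathrm{diag}(x) - xx^\top\in\mathbb{R}^{N\times N}$. For $W\in\{W_h^Q,W_h^K,W_h^V\}$, $\frac{\partial\,\mathrm{Attn}_h(X)}{\partial W}\in\mathbb{R}^{Nd\times Dd}$ denotes the Jacobian matrix of $\mathrm{Attn}_h(X)$ as a function of $W$ (with $X$ and the other two weight matrices fixed), where matrices are vectorized in row-major order: $\mathrm{vec}(d_W\mathrm{Attn}_h(X)) = \frac{\partial\,\mathrm{Attn}_h(X)}{\partial W}\,\mathrm{vec}(dW)$. $\|\cdot\|_2$ of a matrix is the spectral norm (largest singular value). *)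

theory Defs
  imports "HOL-Analysis.Analysis"
begin

section \<open>Spectral norm\<close>

definition singular_values :: "real^'n^'m \<Rightarrow> real set" where
  "singular_values A =
     {s. 0 \<le> s \<and> (\<exists>v. v \<noteq> 0 \<and> (transpose A ** A) *v v = s\<^sup>2 *\<^sub>R v)}"

definition spectral_norm :: "real^'n^'m \<Rightarrow> real" where
  "spectral_norm A = Max (singular_values A)"

lemma inner_gram_matrix:
  fixes A :: "real^'n^'m"
  shows "v \<bullet> ((transpose A ** A) *v w) = (A *v v) \<bullet> (A *v w)"
  by (metis dot_lmul_matrix matrix_vector_mul_assoc transpose_matrix_vector inner_commute)

lemma singular_value_le_onorm:
  fixes A :: "real^'n^'m"
  assumes "s \<in> singular_values A"
  shows "s \<le> onorm ((*v) A)"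
proof -
  from assms obtain v where s: "0 \<le> s" and v: "v \<noteq> 0"
    and e: "(transpose A ** A) *v v = s\<^sup>2 *\<^sub>R v"
    by (auto simp: singular_values_def)
  have "(norm (A *v v))\<^sup>2 = (s * norm v)\<^sup>2"
    using inner_gram_matrix[of v A v] e
    by (simp add: power_mult_distrib power2_norm_eq_inner)
  then have "norm (A *v v) = s * norm v"
    using s by simp
  moreover have "norm (A *v v) \<le> onorm ((*v) A) * norm v"
    by (rule onorm) (rule matrix_vector_mul_bounded_linear)
  ultimately show ?thesis
    using v by simp
qed

lemma onorm_in_singular_values:
  fixes A :: "real^'n^'m"
  shows "onorm ((*v) A) \<in> singular_values A"
proof -
  define s where "s = onorm ((*v) A)"
  have bl: "bounded_linear ((*v) A)" by (rule matrix_vector_mul_bounded_linear)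
  have s0: "0 \<le> s" unfolding s_def by (rule onorm_pos_le[OF bl])
  have ne: "sphere (0::real^'n) 1 \<noteq> {}" by simp
  have "continuous_on (sphere 0 1) (\<lambda>x. norm (A *v x))"
    by (intro continuous_on_norm linear_continuous_on bl)
  then obtain v where v: "norm v = 1" and m: "\<And>w. norm w = 1 \<Longrightarrow> norm (A *v w) \<le> norm (A *v v)"
    using continuous_attains_sup[OF compact_sphere ne] by (force simp: dist_norm)
  have "s \<le> norm (A *v v)"
    unfolding s_def
  proof (rule onorm_le)
    fix w show "norm (A *v w) \<le> norm (A *v v) * norm w"
    proof (cases "w = 0")
      case False
      have "norm (A *v (w /\<^sub>R norm w)) \<le> norm (A *v v)"
        using False by (intro m) simp
      then show ?thesis
        using False by (simp add: matrix_vector_mult_scaleR divide_simps mult.commute)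
    qed simp
  qed
  moreover have bnd: "norm (A *v w) \<le> s * norm w" for w
    unfolding s_def by (rule onorm[OF bl])
  ultimately have sv: "norm (A *v v) = s" using v by (metis mult.right_neutral order_antisym)
  define B where "B w = s\<^sup>2 *\<^sub>R w - (transpose A ** A) *v w" for w
  have q: "a \<bullet> B b = s\<^sup>2 * (a \<bullet> b) - (A *v a) \<bullet> (A *v b)" for a b
    by (simp add: B_def inner_diff_right inner_gram_matrix)
  have psd: "0 \<le> w \<bullet> B w" for w
  proof -
    have "(norm (A *v w))\<^sup>2 \<le> (s * norm w)\<^sup>2" by (intro power_mono bnd) simp
    then show ?thesis by (simp add: q power_mult_distrib power2_norm_eq_inner)
  qed
  have zero: "v \<bullet> B v = 0"
    using v sv by (simp add: q flip: power2_norm_eq_inner)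
  define u where "u = B v"
  have quad: "0 \<le> 2 * t * (u \<bullet> u) + t\<^sup>2 * (u \<bullet> B u)" for t
  proof -
    have "(v + t *\<^sub>R u) \<bullet> B (v + t *\<^sub>R u)
        = v \<bullet> B v + 2 * t * (u \<bullet> B v) + t\<^sup>2 * (u \<bullet> B u)"
      unfolding q
      by (simp add: matrix_vector_right_distrib matrix_vector_mult_scaleR inner_add_left
          inner_add_right inner_commute power2_eq_square algebra_simps)
    then show ?thesis using psd[of "v + t *\<^sub>R u"] zero by (simp add: u_def)
  qed
  have "u \<bullet> u = 0"
  proof (rule ccontr)
    assume "u \<bullet> u \<noteq> 0"
    then have c: "0 < u \<bullet> u" by simp
    define k where "k = u \<bullet> B u"
    define c' where "c' = u \<bullet> u"
    have k: "0 \<le> k" and c': "0 < c'" using psd c by (auto simp: k_def c'_def)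
    have "2 * (- c' / (k + 1)) * c' + (- c' / (k + 1))\<^sup>2 * k
        = - (c'\<^sup>2 * (k + 2)) / (k + 1)\<^sup>2"
      using k by (simp add: divide_simps power2_eq_square) (simp add: algebra_simps)
    also have "\<dots> < 0" using k c' by (simp add: divide_neg_pos)
    finally show False using quad[of "- c' / (k + 1)"] by (simp add: k_def c'_def)
  qed
  then have "(transpose A ** A) *v v = s\<^sup>2 *\<^sub>R v" by (simp add: u_def B_def)
  moreover have "v \<noteq> 0" using v by auto
  ultimately show ?thesis using s0 by (auto simp: singular_values_def s_def)
qed

lemma finite_singular_values:
  fixes A :: "real^'n^'m"
  shows "finite (singular_values A)"
proof -
  define f where "f s = (SOME v. v \<noteq> 0 \<and> (transpose A ** A) *v v = s\<^sup>2 *\<^sub>R v)" for s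
  have f: "f s \<noteq> 0 \<and> (transpose A ** A) *v f s = s\<^sup>2 *\<^sub>R f s" if "s \<in> singular_values A" for s
    using that unfolding f_def singular_values_def mem_Collect_eq
    by (elim conjE) (rule someI_ex)
  have orth: "f s \<bullet> f t = 0"
    if "s \<in> singular_values A" "t \<in> singular_values A" "s \<noteq> t" for s t
  proof -
    have "s\<^sup>2 * (f s \<bullet> f t) = t\<^sup>2 * (f s \<bullet> f t)"
      using f[OF that(1)] f[OF that(2)] inner_gram_matrix[of "f s" A "f t"]
        inner_gram_matrix[of "f t" A "f s"] by (simp add: inner_commute)
    moreover have "s\<^sup>2 \<noteq> t\<^sup>2"
      using that by (auto simp: singular_values_def power2_eq_iff)
    ultimately show ?thesis by simp
  qed
  have inj: "inj_on f (singular_values A)"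
    using orth f by (metis inj_onI inner_eq_zero_iff)
  have "pairwise orthogonal (f ` singular_values A)"
    using orth by (auto simp: pairwise_def orthogonal_def)
  then have "independent (f ` singular_values A)"
    using f by (intro pairwise_orthogonal_independent) auto
  then show ?thesis
    using independent_imp_finite finite_imageD inj by blast
qed

lemma spectral_norm_eq_onorm: "spectral_norm A = onorm ((*v) A)"
  unfolding spectral_norm_def
  by (intro Max_eqI finite_singular_values singular_value_le_onorm onorm_in_singular_values)

section \<open>Jacobian of a matrix-valued function of a matrix\<close>

text \<open>An \<open>r \<times> c\<close> matrix is vectorized as a vector indexed by pairs (row, column); read
  lexicographically, this index set is the row-major enumeration of the entries.\<close>

definition vectorize :: "'a^'c^'r \<Rightarrow> 'a^('r \<times> 'c)" where
  "vectorize A = (\<chi> p. A $ fst p $ snd p)"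

definition matricize :: "'a^('r \<times> 'c) \<Rightarrow> 'a^'c^'r" where
  "matricize v = (\<chi> i j. v $ (i, j))"

lemma matricize_vectorize [simp]: "matricize (vectorize A) = A"
  by (simp add: vectorize_def matricize_def vec_eq_iff)

lemma vectorize_matricize [simp]: "vectorize (matricize v) = v"
  by (simp add: vectorize_def matricize_def vec_eq_iff)

definition mat_jacobian ::
  "(real^'c^'r \<Rightarrow> real^'k^'m) \<Rightarrow> real^'c^'r \<Rightarrow> real^('r \<times> 'c)^('m \<times> 'k)" where
  "mat_jacobian F W = jacobian (\<lambda>w. vectorize (F (matricize w))) (at (vectorize W))"

lemma bounded_linear_vectorize:
  "bounded_linear (vectorize :: real^'c^'r \<Rightarrow> real^('r \<times> 'c))"
  by (intro linear_conv_bounded_linear[THEN iffD1] linearI)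
    (simp_all add: vectorize_def vec_eq_iff)

lemma bounded_linear_matricize:
  "bounded_linear (matricize :: real^('r \<times> 'c) \<Rightarrow> real^'c^'r)"
  by (intro linear_conv_bounded_linear[THEN iffD1] linearI)
    (simp_all add: matricize_def vec_eq_iff)

lemma vectorize_derivative:
  fixes F :: "real^'c^'r \<Rightarrow> real^'k^'m"
  assumes "(F has_derivative F') (at W)"
  shows "vectorize (F' H) = mat_jacobian F W *v vectorize H"
proof -
  have F: "(F has_derivative F') (at (matricize (vectorize W)))"
    using assms by simp
  have "((\<lambda>w. vectorize (F (matricize w))) has_derivative (\<lambda>h. vectorize (F' (matricize h))))
          (at (vectorize W))"
    by (intro bounded_linear.has_derivative[OF bounded_linear_vectorize]
        has_derivative_compose[OF bounded_linear.has_derivative[OF bounded_linear_matricize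
          has_derivative_ident] F])
  moreover from this have "((\<lambda>w. vectorize (F (matricize w))) has_derivative
      (\<lambda>h. mat_jacobian F W *v h)) (at (vectorize W))"
    unfolding mat_jacobian_def by (metis differentiableI jacobian_works)
  ultimately have "(\<lambda>h. vectorize (F' (matricize h))) = (\<lambda>h. mat_jacobian F W *v h)"
    by (rule has_derivative_unique)
  then show ?thesis by (metis matricize_vectorize)
qed

section \<open>Dot-product self-attention\<close>

definition softmax :: "real^'n \<Rightarrow> real^'n" where
  "softmax z = (\<chi> i. exp (z $ i) / (\<Sum>j\<in>UNIV. exp (z $ j)))"

definition row_softmax :: "real^'n^'m \<Rightarrow> real^'n^'m" where
  "row_softmax A = (\<chi> i. softmax (row i A))"

definition attn_probs :: "real^'D^'N \<Rightarrow> real^'d^'D \<Rightarrow> real^'d^'D \<Rightarrow> real^'N^'N" where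
  "attn_probs X WQ WK =
     row_softmax ((1 / sqrt (real CARD('d))) *\<^sub>R (X ** WQ ** transpose WK ** transpose X))"

definition attn :: "real^'D^'N \<Rightarrow> real^'d^'D \<Rightarrow> real^'d^'D \<Rightarrow> real^'d^'D \<Rightarrow> real^'d^'N" where
  "attn X WQ WK WV = attn_probs X WQ WK ** X ** WV"

text \<open>\<open>diag(x) - x x\<^sup>T\<close>\<close>

definition diag_minus_outer :: "real^'n \<Rightarrow> real^'n^'n" where
  "diag_minus_outer x = (\<chi> i j. if i = j then x $ i else 0) - (\<chi> i j. x $ i * x $ j)"

lemma differentiable_matrixI:
  fixes F :: "'a::real_normed_vector \<Rightarrow> real^'k^'m"
  assumes "\<And>i j. (\<lambda>x. F x $ i $ j) differentiable (at x)"
  shows "F differentiable (at x)"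
proof -
  from assms obtain G where G: "\<And>i j. ((\<lambda>x. F x $ i $ j) has_derivative G i j) (at x)"
    unfolding differentiable_def by metis
  have "(F has_derivative (\<lambda>h. \<chi> i j. G i j h)) (at x)"
    by (subst has_derivative_componentwise_within)
      (auto simp: Basis_vec_def inner_axis intro!: G)
  then show ?thesis by (rule differentiableI)
qed

lemma differentiable_matrix_nth:
  fixes F :: "'a::real_normed_vector \<Rightarrow> real^'k^'m"
  assumes "F differentiable (at x)"
  shows "(\<lambda>x. F x $ i $ j) differentiable (at x)"
proof -
  obtain G where "(F has_derivative G) (at x)" using assms by (auto simp: differentiable_def)
  then have "((\<lambda>x. F x $ i $ j) has_derivative (\<lambda>h. G h $ i $ j)) (at x)"
    by (intro bounded_linear.has_derivative[OF bounded_linear_vec_nth])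
  then show ?thesis by (rule differentiableI)
qed

lemma differentiable_matrix_mult:
  fixes F :: "'a::real_normed_vector \<Rightarrow> real^'k^'m" and G :: "'a \<Rightarrow> real^'l^'k"
  assumes "F differentiable (at x)" "G differentiable (at x)"
  shows "(\<lambda>x. F x ** G x) differentiable (at x)"
  by (rule differentiable_matrixI)
    (simp add: matrix_matrix_mult_def differentiable_matrix_nth assms)

lemma differentiable_transpose:
  fixes F :: "'a::real_normed_vector \<Rightarrow> real^'k^'m"
  assumes "F differentiable (at x)"
  shows "(\<lambda>x. transpose (F x)) differentiable (at x)"
  by (rule differentiable_matrixI) (simp add: transpose_def differentiable_matrix_nth assms)

lemma differentiable_row_softmax:
  fixes F :: "'a::real_normed_vector \<Rightarrow> real^'k^'m"
  assumes "F differentiable (at x)"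
  shows "(\<lambda>x. row_softmax (F x)) differentiable (at x)"
proof (rule differentiable_matrixI)
  fix i j
  have e: "(\<lambda>x. exp (F x $ i $ l)) differentiable (at x)" for l
    using differentiable_matrix_nth[OF assms, of i l]
    by (auto simp: differentiable_def intro: has_derivative_exp)
  have "(\<Sum>l\<in>UNIV. exp (F x $ i $ l)) \<noteq> 0"
    by (metis UNIV_not_empty exp_gt_zero finite less_irrefl sum_pos)
  then show "(\<lambda>x. row_softmax (F x) $ i $ j) differentiable (at x)"
    by (simp add: row_softmax_def softmax_def row_def e)
qed

lemma attn_differentiable:
  shows "(\<lambda>W. attn X W WK WV) differentiable (at WQ)"
    and "(\<lambda>W. attn X WQ W WV) differentiable (at WK)"
    and "(\<lambda>W. attn X WQ WK W) differentiable (at WV)"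
  unfolding attn_def attn_probs_def
  by (intro differentiable_matrix_mult differentiable_row_softmax differentiable_scaleR
      differentiable_transpose differentiable_const differentiable_ident)+

end

theory Submission
  imports Defs
begin

text \<open>The norm of a matrix type is the Frobenius norm, which \<open>vectorize\<close> turns into the Euclidean
  norm. So a bound \<open>C\<close> on the spectral norm of a Jacobian amounts to \<open>\<parallel>F' H\<parallel> \<le> C \<parallel>H\<parallel>\<close> in Frobenius
  norms, and the latter follows from \<open>\<parallel>A B\<parallel>\<^sub>F \<le> \<parallel>A\<parallel>\<^sub>2 \<parallel>B\<parallel>\<^sub>F\<close> and \<open>\<parallel>A B\<parallel>\<^sub>F \<le> \<parallel>A\<parallel>\<^sub>F \<parallel>B\<parallel>\<^sub>2\<close>, since the derivative
  of the row-wise softmax acts on row \<open>i\<close> of the increment by the matrix \<open>diag p - p p\<^sup>T\<close>, where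
  \<open>p\<close> is row \<open>i\<close> of the softmax. The last inequality is Jensen's
  inequality for the square in each row, whose entries are convex weights.\<close>

section \<open>Spectral and Frobenius norms\<close>

lemma spectral_norm_nonneg: "0 \<le> spectral_norm A"
  by (simp add: spectral_norm_eq_onorm onorm_pos_le)

lemma norm_matrix_vector_mult_le: "norm (A *v x) \<le> spectral_norm A * norm x"
  by (simp add: spectral_norm_eq_onorm onorm)

lemma spectral_norm_leI:
  assumes "\<And>x. norm (A *v x) \<le> c * norm x"
  shows "spectral_norm A \<le> c"
  unfolding spectral_norm_eq_onorm by (rule onorm_le) (rule assms)

text \<open>For \<open>z = transpose A *v y\<close>, adjointness and Cauchy-Schwarz bound
  \<open>z \<bullet> z = y \<bullet> (A *v z)\<close> by
  \<open>norm y * spectral_norm A * norm z\<close>; cancel one factor \<open>norm z\<close>. Since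
  transposition is an involution, equality follows.\<close>

lemma spectral_norm_transpose_le: "spectral_norm (transpose A) \<le> spectral_norm A"
proof (rule spectral_norm_leI)
  fix y
  define z where "z = transpose A *v y"
  have "norm z * norm z = z \<bullet> z"
    by (simp add: power2_norm_eq_inner flip: power2_eq_square)
  also have "\<dots> = y \<bullet> (A *v z)"
    by (metis dot_lmul_matrix transpose_matrix_vector z_def)
  also have "\<dots> \<le> norm y * norm (A *v z)"
    by (rule norm_cauchy_schwarz)
  also have "\<dots> \<le> norm y * (spectral_norm A * norm z)"
    by (intro mult_left_mono norm_matrix_vector_mult_le) simp
  finally have "norm z * norm z \<le> (spectral_norm A * norm y) * norm z"
    by (simp add: algebra_simps)
  then have "norm z \<le> spectral_norm A * norm y"
    by (cases "norm z = 0") (auto simp: spectral_norm_nonneg)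
  then show "norm (transpose A *v y) \<le> spectral_norm A * norm y"
    by (simp add: z_def)
qed

lemma spectral_norm_transpose: "spectral_norm (transpose A) = spectral_norm A"
  by (metis order_antisym spectral_norm_transpose_le transpose_transpose)

text \<open>The Frobenius norm is the Euclidean norm of the vector of row norms, so a uniform bound
  on rows passes to the whole matrix.\<close>

lemma norm_le_rowwise:
  fixes A :: "real^'n^'m" and B :: "real^'k^'m"
  assumes "\<And>i. norm (A $ i) \<le> c * norm (B $ i)" and "0 \<le> c"
  shows "norm A \<le> c * norm B"
proof -
  have "norm A \<le> L2_set (\<lambda>i. c * norm (B $ i)) UNIV"
    unfolding norm_vec_def[of A] by (rule L2_set_mono) (auto intro: assms)
  then show ?thesis
    using assms(2) by (simp add: norm_vec_def[of B] L2_set_right_distrib)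
qed

lemma norm_transpose:
  fixes A :: "real^'n^'m"
  shows "norm (transpose A) = norm A"
proof -
  have "(\<Sum>i\<in>UNIV. \<Sum>j\<in>UNIV. (A $ j $ i)\<^sup>2) = (\<Sum>j\<in>UNIV. \<Sum>i\<in>UNIV. (A $ j $ i)\<^sup>2)"
    by (rule sum.swap)
  then show ?thesis
    by (simp add: norm_vec_def L2_set_def transpose_def sum_nonneg)
qed

lemma norm_vectorize:
  fixes A :: "real^'n^'m"
  shows "norm (vectorize A) = norm A"
  by (simp add: norm_vec_def L2_set_def vectorize_def sum_nonneg sum.cartesian_product case_prod_beta)

text \<open>Each row of the product is \<open>transpose B\<close> applied to the same row of
  \<open>A\<close>, and \<open>transpose B\<close> has the spectral norm of
  \<open>B\<close>.\<close>

lemma norm_matrix_mult_right: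
  fixes A :: "real^'n^'m" and B :: "real^'k^'n"
  shows "norm (A ** B) \<le> spectral_norm B * norm A"
proof (rule norm_le_rowwise[OF _ spectral_norm_nonneg])
  fix i
  have "(A ** B) $ i = transpose B *v (A $ i)"
    by (simp add: vec_eq_iff matrix_matrix_mult_def vector_matrix_mult_def mult.commute)
  then show "norm ((A ** B) $ i) \<le> spectral_norm B * norm (A $ i)"
    by (metis norm_matrix_vector_mult_le spectral_norm_transpose)
qed

lemma norm_matrix_mult_left:
  fixes A :: "real^'n^'m" and B :: "real^'k^'n"
  shows "norm (A ** B) \<le> spectral_norm A * norm B"
  using norm_matrix_mult_right[of "transpose B" "transpose A"]
  by (simp add: norm_transpose spectral_norm_transpose flip: matrix_transpose_mul)

text \<open>Since \<open>vectorize\<close> is an isometry, the Jacobian stretches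
  \<open>vectorize H\<close> exactly as \<open>F'\<close> stretches \<open>H\<close> in Frobenius
  norm.\<close>

lemma spectral_norm_mat_jacobian_le:
  fixes F :: "real^'c^'r \<Rightarrow> real^'k^'m"
  assumes "(F has_derivative F') (at W)" and "\<And>H. norm (F' H) \<le> c * norm H"
  shows "spectral_norm (mat_jacobian F W) \<le> c"
proof (rule spectral_norm_leI)
  fix x
  show "norm (mat_jacobian F W *v x) \<le> c * norm x"
    using vectorize_derivative[OF assms(1), of "matricize x"] assms(2)[of "matricize x"]
      norm_vectorize[of "F' (matricize x)"] norm_vectorize[of "matricize x"] by simp
qed

lemma bounded_linear_matrix_mult_right:
  fixes A :: "real^'n^'m"
  shows "bounded_linear (\<lambda>B :: real^'k^'n. A ** B)"
  by (intro linear_conv_bounded_linear[THEN iffD1] linearI)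
    (simp_all add: matrix_matrix_mult_def vec_eq_iff sum.distrib sum_distrib_left algebra_simps)

lemma bounded_linear_matrix_mult_left:
  fixes B :: "real^'k^'n"
  shows "bounded_linear (\<lambda>A :: real^'n^'m. A ** B)"
  by (intro linear_conv_bounded_linear[THEN iffD1] linearI)
    (simp_all add: matrix_matrix_mult_def vec_eq_iff sum.distrib sum_distrib_left algebra_simps)

lemma bounded_linear_transpose:
  "bounded_linear (transpose :: real^'n^'m \<Rightarrow> real^'m^'n)"
  by (intro linear_conv_bounded_linear[THEN iffD1] linearI)
    (simp_all add: transpose_def vec_eq_iff)

section \<open>Derivative of the softmax\<close>

lemma sum_exp_pos: "0 < (\<Sum>j\<in>UNIV. exp (z $ j :: real))" for z :: "real^'n"
  by (intro sum_pos) auto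

lemma diag_minus_outer_mult_nth:
  "(diag_minus_outer p *v h) $ i = p $ i * h $ i - p $ i * (\<Sum>j\<in>UNIV. p $ j * h $ j)"
proof -
  have "(\<Sum>j\<in>UNIV. (if i = j then p $ i else 0) * h $ j) = p $ i * h $ i"
    by (simp add: if_distrib[of "\<lambda>x. x * _"] cong: if_cong)
  then show ?thesis
    by (simp add: diag_minus_outer_def matrix_vector_mult_def left_diff_distrib sum_subtractf
        sum_distrib_left mult.assoc)
qed

text \<open>Quotient rule in each coordinate, with normalizer \<open>S\<close>; its outcome is then
  matched with \<open>diag_minus_outer_mult_nth\<close>.\<close>

lemma has_derivative_softmax:
  fixes z :: "real^'n"
  shows "(softmax has_derivative (\<lambda>h. diag_minus_outer (softmax z) *v h)) (at z)"
proof (subst has_derivative_componentwise_within, rule ballI)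
  fix b :: "real^'n" assume "b \<in> Basis"
  then obtain i where b: "b = axis i 1"
    by (auto simp: Basis_vec_def)
  define S where "S = (\<Sum>j\<in>UNIV. exp (z $ j))"
  have S: "0 < S"
    using sum_exp_pos[of z] by (simp add: S_def)
  have nth: "((\<lambda>z::real^'n. z $ j) has_derivative (\<lambda>h. h $ j)) (at z)" for j
    by (rule bounded_linear_imp_has_derivative[OF bounded_linear_vec_nth])
  have e: "((\<lambda>z::real^'n. exp (z $ j)) has_derivative (\<lambda>h. h $ j * exp (z $ j))) (at z)" for j
    by (rule has_derivative_eq_rhs[OF has_derivative_exp[OF nth]]) (simp add: fun_eq_iff)
  have "((\<lambda>z::real^'n. \<Sum>j\<in>UNIV. exp (z $ j)) has_derivative
      (\<lambda>h. \<Sum>j\<in>UNIV. h $ j * exp (z $ j))) (at z)"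
    by (intro has_derivative_sum e)
  from has_derivative_divide'[OF e[of i] this] S
  have "((\<lambda>z::real^'n. exp (z $ i) / (\<Sum>j\<in>UNIV. exp (z $ j))) has_derivative
      (\<lambda>h. (h $ i * exp (z $ i) * S - exp (z $ i) * (\<Sum>j\<in>UNIV. h $ j * exp (z $ j))) / (S * S)))
      (at z)"
    by (simp add: S_def)
  moreover have "(h $ i * exp (z $ i) * S - exp (z $ i) * (\<Sum>j\<in>UNIV. h $ j * exp (z $ j))) / (S * S)
      = (diag_minus_outer (softmax z) *v h) $ i" for h
  proof -
    have "(\<Sum>j\<in>UNIV. softmax z $ j * h $ j) = (\<Sum>j\<in>UNIV. h $ j * exp (z $ j)) / S"
      by (simp add: softmax_def S_def sum_divide_distrib mult.commute)
    then show ?thesis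
      using S by (simp add: diag_minus_outer_mult_nth) (simp add: softmax_def S_def[symmetric] field_simps)
  qed
  ultimately show "((\<lambda>x. softmax x \<bullet> b) has_derivative
      (\<lambda>x. (diag_minus_outer (softmax z) *v x) \<bullet> b)) (at z)"
    by (simp add: b inner_axis softmax_def)
qed

text \<open>Allows the row-wise softmax to be differentiated one row at a time.\<close>

lemma has_derivative_vec_componentwise:
  fixes f :: "'a::real_normed_vector \<Rightarrow> ('b::euclidean_space)^'m"
  assumes "\<And>i. ((\<lambda>x. f x $ i) has_derivative (\<lambda>h. f' h $ i)) (at x)"
  shows "(f has_derivative f') (at x)"
  by (subst has_derivative_componentwise_within)
    (auto simp: Basis_vec_def inner_axis intro!: has_derivative_inner_left assms)

lemma has_derivative_row_softmax:
  fixes A :: "real^'n^'m"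
  shows "(row_softmax has_derivative
    (\<lambda>H. \<chi> i. diag_minus_outer (row i (row_softmax A)) *v (H $ i))) (at A)"
proof (rule has_derivative_vec_componentwise)
  fix i
  have "((\<lambda>A::real^'n^'m. A $ i) has_derivative (\<lambda>H. H $ i)) (at A)"
    by (rule bounded_linear_imp_has_derivative[OF bounded_linear_vec_nth])
  from has_derivative_compose[OF this has_derivative_softmax]
  show "((\<lambda>A. row_softmax A $ i) has_derivative
      (\<lambda>H. (\<chi> i. diag_minus_outer (row i (row_softmax A)) *v (H $ i)) $ i)) (at A)"
    by (simp add: row_softmax_def row_def vec_nth_inverse)
qed

section \<open>Jacobians through the attention probabilities\<close>

text \<open>Common core of the query and key bounds: the scores are linear in either weight, so the
  two cases differ only in \<open>L\<close> and its constant \<open>K\<close>.\<close>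

lemma spectral_norm_mat_jacobian_softmax_le:
  fixes L :: "real^'c^'r \<Rightarrow> real^'n^'m" and X :: "real^'D^'n" and V :: "real^'d^'D"
  assumes L: "bounded_linear L" and K: "\<And>H. norm (L H) \<le> K * norm H"
  shows "spectral_norm (mat_jacobian (\<lambda>W. row_softmax (L W) ** X ** V) W)
    \<le> spectral_norm V * (spectral_norm X
      * ((MAX i. spectral_norm (diag_minus_outer (row i (row_softmax (L W))))) * K))"
    (is "_ \<le> _ * (_ * (?M * K))")
proof (rule spectral_norm_mat_jacobian_le)
  \<comment> \<open>\<open>L\<close> is its own derivative, so the chain rule gives \<open>D\<close>
    as the derivative of the probabilities at \<open>W\<close>.\<close>
  define D where "D H = (\<chi> i. diag_minus_outer (row i (row_softmax (L W))) *v (L H $ i))" for H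
  have "((\<lambda>W. row_softmax (L W)) has_derivative D) (at W)"
    unfolding D_def
    by (rule has_derivative_compose[OF bounded_linear_imp_has_derivative[OF L]
          has_derivative_row_softmax])
  then show "((\<lambda>W. row_softmax (L W) ** X ** V) has_derivative (\<lambda>H. D H ** X ** V)) (at W)"
    by (intro bounded_linear.has_derivative[OF bounded_linear_matrix_mult_left])
  fix H
  have le: "spectral_norm (diag_minus_outer (row i (row_softmax (L W)))) \<le> ?M" for i
    by (intro Max_ge) auto
  have M: "0 \<le> ?M"
    using le spectral_norm_nonneg order_trans by blast
  have "norm (D H) \<le> ?M * norm (L H)"
  proof (rule norm_le_rowwise[OF _ M])
    fix i
    show "norm (D H $ i) \<le> ?M * norm (L H $ i)"
      using norm_matrix_vector_mult_le[of "diag_minus_outer (row i (row_softmax (L W)))" "L H $ i"]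
        mult_right_mono[OF le[of i] norm_ge_zero[of "L H $ i"]] by (simp add: D_def)
  qed
  also have "\<dots> \<le> ?M * (K * norm H)"
    by (intro mult_left_mono K M)
  finally have D: "norm (D H) \<le> ?M * (K * norm H)" .
  have "norm (D H ** X ** V) \<le> spectral_norm V * norm (D H ** X)"
    by (rule norm_matrix_mult_right)
  also have "\<dots> \<le> spectral_norm V * (spectral_norm X * norm (D H))"
    by (intro mult_left_mono norm_matrix_mult_right spectral_norm_nonneg)
  also have "\<dots> \<le> spectral_norm V * (spectral_norm X * (?M * (K * norm H)))"
    by (intro mult_left_mono D spectral_norm_nonneg)
  finally show "norm (D H ** X ** V) \<le> spectral_norm V * (spectral_norm X * (?M * K)) * norm H"
    by (simp only: mult.assoc)
qed

text \<open>The two bounds keep the Frobenius norm on the factor that will vary, \<open>A\<close>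
  for the query and \<open>B\<close> for the key, and pull out spectral norms of the others.\<close>

lemma norm_score_le:
  fixes X :: "real^'D^'N" and A B :: "real^'d^'D"
  shows "norm (X ** A ** transpose B ** transpose X)
      \<le> spectral_norm X * (spectral_norm B * (spectral_norm X * norm A))"
    and "norm (X ** A ** transpose B ** transpose X)
      \<le> spectral_norm X * (spectral_norm X * (spectral_norm A * norm B))"
proof -
  have 1: "norm (X ** A ** transpose B ** transpose X) \<le> spectral_norm X * norm (X ** A ** transpose B)"
    by (metis norm_matrix_mult_right spectral_norm_transpose)
  have "norm (X ** A ** transpose B) \<le> spectral_norm B * norm (X ** A)"
    by (metis norm_matrix_mult_right spectral_norm_transpose)
  also have "\<dots> \<le> spectral_norm B * (spectral_norm X * norm A)"
    by (intro mult_left_mono norm_matrix_mult_left spectral_norm_nonneg)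
  finally show "norm (X ** A ** transpose B ** transpose X)
      \<le> spectral_norm X * (spectral_norm B * (spectral_norm X * norm A))"
    using 1 by (meson mult_left_mono order_trans spectral_norm_nonneg)
  \<comment> \<open>Reassociating the product lets \<open>X\<close> and then \<open>A\<close> be
    removed from the left, leaving the Frobenius norm of \<open>transpose B\<close>.\<close>
  have "norm (X ** A ** transpose B) \<le> spectral_norm X * norm (A ** transpose B)"
    by (metis matrix_mul_assoc norm_matrix_mult_left)
  also have "\<dots> \<le> spectral_norm X * (spectral_norm A * norm B)"
    by (metis mult_left_mono norm_matrix_mult_left norm_transpose spectral_norm_nonneg)
  finally show "norm (X ** A ** transpose B ** transpose X)
      \<le> spectral_norm X * (spectral_norm X * (spectral_norm A * norm B))"
    using 1 by (meson mult_left_mono order_trans spectral_norm_nonneg)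
qed

section \<open>Row-stochastic matrices\<close>

lemma softmax_nonneg: "0 \<le> softmax z $ i"
  using sum_exp_pos[of z] by (simp add: softmax_def)

lemma sum_softmax: "(\<Sum>i\<in>UNIV. softmax z $ i) = 1"
  using sum_exp_pos[of z] by (simp add: softmax_def flip: sum_divide_distrib)

lemma spectral_norm_stochastic_le:
  fixes P :: "real^'n^'m"
  assumes nonneg: "\<And>i j. 0 \<le> P $ i $ j" and sum: "\<And>i. (\<Sum>j\<in>UNIV. P $ i $ j) = 1"
  shows "spectral_norm P \<le> sqrt (MAX j. \<Sum>i\<in>UNIV. P $ i $ j)"
proof (rule spectral_norm_leI)
  fix x :: "real^'n"
  define M where "M = (MAX j. \<Sum>i\<in>UNIV. P $ i $ j)"
  have le: "(\<Sum>i\<in>UNIV. P $ i $ j) \<le> M" for j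
    unfolding M_def by (intro Max_ge) auto
  have jensen: "(\<Sum>j\<in>UNIV. P $ i $ j * x $ j)\<^sup>2 \<le> (\<Sum>j\<in>UNIV. P $ i $ j * (x $ j)\<^sup>2)" for i
    using convex_on_sum[of UNIV UNIV "\<lambda>x. x\<^sup>2" "\<lambda>j. P $ i $ j" "\<lambda>j. x $ j"]
    by (simp add: convex_power2 nonneg sum)
  have "(norm (P *v x))\<^sup>2 = (\<Sum>i\<in>UNIV. (\<Sum>j\<in>UNIV. P $ i $ j * x $ j)\<^sup>2)"
    by (simp add: norm_vec_def L2_set_def sum_nonneg matrix_vector_mult_def)
  also have "\<dots> \<le> (\<Sum>i\<in>UNIV. \<Sum>j\<in>UNIV. P $ i $ j * (x $ j)\<^sup>2)"
    by (intro sum_mono jensen)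
  \<comment> \<open>After the exchange, the coefficient of \<open>(x $ j)\<^sup>2\<close> is the sum
    of column \<open>j\<close>, which is at most \<open>M\<close>.\<close>
  also have "\<dots> = (\<Sum>j\<in>UNIV. \<Sum>i\<in>UNIV. P $ i $ j * (x $ j)\<^sup>2)"
    by (rule sum.swap)
  also have "\<dots> \<le> (\<Sum>j\<in>UNIV. M * (x $ j)\<^sup>2)"
    by (intro sum_mono) (simp add: le mult_right_mono flip: sum_distrib_right)
  also have "\<dots> = M * (norm x)\<^sup>2"
    by (simp add: norm_vec_def L2_set_def sum_nonneg sum_distrib_left)
  finally have "norm (P *v x) \<le> sqrt (M * (norm x)\<^sup>2)"
    by (rule real_le_rsqrt)
  then show "norm (P *v x) \<le> sqrt (MAX j. \<Sum>i\<in>UNIV. P $ i $ j) * norm x"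
    by (simp add: real_sqrt_mult M_def)
qed

section \<open>Bounds for the three weight Jacobians\<close>

theorem proposition2:
  fixes X :: "real^'D^'N" and WQ WK WV :: "real^'d^'D" and P :: "real^'N^'N"
  assumes "P = attn_probs X WQ WK"
  shows "spectral_norm (mat_jacobian (\<lambda>W. attn X W WK WV) WQ)
           \<le> 1 / sqrt (real CARD('d)) * spectral_norm WV * spectral_norm WK
             * spectral_norm X ^ 3 * (MAX i. spectral_norm (diag_minus_outer (row i P)))
       \<and> spectral_norm (mat_jacobian (\<lambda>W. attn X WQ W WV) WK)
           \<le> 1 / sqrt (real CARD('d)) * spectral_norm WV * spectral_norm WQ
             * spectral_norm X ^ 3 * (MAX i. spectral_norm (diag_minus_outer (row i P)))
       \<and> spectral_norm (mat_jacobian (\<lambda>W. attn X WQ WK W) WV)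
           \<le> spectral_norm P * spectral_norm X
       \<and> spectral_norm P * spectral_norm X
           \<le> sqrt (MAX j. \<Sum>i\<in>UNIV. P $ i $ j) * spectral_norm X"
proof (intro conjI)
  define c where "c = 1 / sqrt (real CARD('d))"
  \<comment> \<open>The scaled scores are linear in each argument separately, so fixing either
    weight gives an instance of the common core.\<close>
  define L where "L A B = c *\<^sub>R (X ** A ** transpose B ** transpose X)" for A B :: "real^'d^'D"
  have c: "0 \<le> c" by (simp add: c_def)
  have probs: "attn_probs X A B = row_softmax (L A B)" for A B :: "real^'d^'D"
    by (simp add: attn_probs_def L_def c_def)
  have P: "row_softmax (L WQ WK) = P"
    by (simp add: assms probs)
  have LQ: "bounded_linear (\<lambda>W. L W WK)"
    unfolding L_def
    by (intro bounded_linear_const_scaleR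
        bounded_linear_compose[OF bounded_linear_matrix_mult_left]
        bounded_linear_matrix_mult_right)
  have LK: "bounded_linear (L WQ)"
    unfolding L_def
    by (intro bounded_linear_const_scaleR
        bounded_linear_compose[OF bounded_linear_matrix_mult_left]
        bounded_linear_compose[OF bounded_linear_matrix_mult_right] bounded_linear_transpose)
  \<comment> \<open>The scores contribute two factors \<open>spectral_norm X\<close>; the third in
    the cube comes from the \<open>X\<close> that multiplies the probabilities.\<close>
  have KQ: "norm (L H WK) \<le> c * (spectral_norm X * (spectral_norm WK * spectral_norm X)) * norm H" for H
    using mult_left_mono[OF norm_score_le(1)[of X H WK] c] c by (simp add: L_def mult.assoc)
  have KK: "norm (L WQ H) \<le> c * (spectral_norm X * (spectral_norm X * spectral_norm WQ)) * norm H" for H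
    using mult_left_mono[OF norm_score_le(2)[of X WQ H] c] c by (simp add: L_def mult.assoc)
  show "spectral_norm (mat_jacobian (\<lambda>W. attn X W WK WV) WQ)
      \<le> 1 / sqrt (real CARD('d)) * spectral_norm WV * spectral_norm WK
        * spectral_norm X ^ 3 * (MAX i. spectral_norm (diag_minus_outer (row i P)))"
    using spectral_norm_mat_jacobian_softmax_le[OF LQ KQ, of X WV WQ]
    unfolding attn_def probs P by (simp add: c_def power3_eq_cube ac_simps)
  show "spectral_norm (mat_jacobian (\<lambda>W. attn X WQ W WV) WK)
      \<le> 1 / sqrt (real CARD('d)) * spectral_norm WV * spectral_norm WQ
        * spectral_norm X ^ 3 * (MAX i. spectral_norm (diag_minus_outer (row i P)))"
    using spectral_norm_mat_jacobian_softmax_le[OF LK KK, of X WV WK]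
    unfolding attn_def probs P by (simp add: c_def power3_eq_cube ac_simps)
  show "spectral_norm (mat_jacobian (\<lambda>W. attn X WQ WK W) WV) \<le> spectral_norm P * spectral_norm X"
  proof (rule spectral_norm_mat_jacobian_le)
    \<comment> \<open>The probabilities do not depend on the value weight, so attention is linear in
      it and is its own derivative.\<close>
    show "((\<lambda>W. attn X WQ WK W) has_derivative (\<lambda>H. P ** X ** H)) (at WV)"
      unfolding attn_def assms
      by (rule bounded_linear_imp_has_derivative[OF bounded_linear_matrix_mult_right])
    fix H :: "real^'d^'D"
    have "norm (P ** (X ** H)) \<le> spectral_norm P * norm (X ** H)"
      by (rule norm_matrix_mult_left)
    also have "\<dots> \<le> spectral_norm P * (spectral_norm X * norm H)"
      by (intro mult_left_mono norm_matrix_mult_left spectral_norm_nonneg)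
    finally show "norm (P ** X ** H) \<le> spectral_norm P * spectral_norm X * norm H"
      by (simp add: matrix_mul_assoc mult.assoc)
  qed
  show "spectral_norm P * spectral_norm X
      \<le> sqrt (MAX j. \<Sum>i\<in>UNIV. P $ i $ j) * spectral_norm X"
    by (intro mult_right_mono spectral_norm_stochastic_le spectral_norm_nonneg)
      (simp_all add: row_softmax_def softmax_nonneg sum_softmax flip: P)
qed

end
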